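(* Let $\mathcal H$ be a real Hilbert space, let $f_1,f_2:\mathcal H\to(-\infty,+\infty]$ be proper lower semicontinuous convex functions, and let $\lambda_1,\lambda_2>0$ with $\lambda_1+\lambda_2=1$. Let $\bar\phi$ be the dual solution, i.e. the (unique) solution, assumed to exist, of $$\max_{\phi\in\mathcal H}\Big[-\Big(\frac{f_1}{\lambda_2}\Big)^*(-\phi)-\Big(\frac{f_2}{\lambda_1}\Big)^*(\phi)-\frac{\|\phi\|^2}{2}\Big].$$ Let $E:=\operatorname{Fix}(\operatorname{Prox}_{f_1/\lambda_2}\operatorname{Prox}_{f_2/\lambda_1})$ and define $T_1:E\to\operatorname{Fix}(\lambda_1\operatorname{Prox}_{f_1}+\lambda_2\operatorname{Prox}_{f_2})$ by $$T_1(x)=\lambda_1x+\lambda_2\operatorname{Prox}_{f_2/\lambda_1}(x)=x-\lambda_2\bar\phi$$ (in particular the two expressions agree on $E$). Then $T_1$ is a homeomorphism with $T_1^{-1}(z)=\operatorname{Prox}_{f_1}(z)$. Consequently, $$\operatorname{Fix}(\lambda_1\operatorname{Prox}_{f_1}+\lambda_2\operatorname{Prox}_{f_2})=E-\lambda_2\bar\phi.$$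
   Context: For proper lower semicontinuous convex $f$ on $\mathcal H$: $\operatorname{Prox}_f:=(\operatorname{Id}+\partial f)^{-1}$ is the proximal mapping (single-valued, full domain), with $\partial f$ the convex subdifferential; $f^*(x^* )=\sup_x(\langle x^*,x\rangle-f(x))$ is the Fenchel conjugate. $\operatorname{Fix}T=\{x:Tx=x\}$. A solution of the dual problem is a point at which the maximum is attained with finite value. A homeomorphism is a continuous bijection with continuous inverse (norm topology). *)

theory Defs
  imports "HOL-Analysis.Analysis"
begin

section \<open>Extended-real-valued convex functions on a real inner product space\<close>

text \<open>A function into \<open>(-\<infinity>, +\<infinity>]\<close> is an \<^typ>\<open>ereal\<close>-valued function omitting \<open>-\<infinity>\<close>; this is part of
  properness.\<close>

definition proper :: "('a \<Rightarrow> ereal) \<Rightarrow> bool"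
  where "proper f \<longleftrightarrow> (\<forall>x. f x \<noteq> -\<infinity>) \<and> (\<exists>x. f x \<noteq> \<infinity>)"

definition lower_semicontinuous :: "('a::topological_space \<Rightarrow> ereal) \<Rightarrow> bool"
  where "lower_semicontinuous f \<longleftrightarrow> (\<forall>x. f x \<le> Liminf (at x) f)"

text \<open>Same shape as \<^const>\<open>convex_on\<close>, which is restricted to real values. For functions omitting
  \<open>-\<infinity>\<close> no \<open>\<infinity> - \<infinity>\<close> arises, and the convention \<open>0 * \<infinity> = 0\<close> makes the cases \<open>u = 0\<close>
  and \<open>v = 0\<close> trivially true.\<close>

definition ereal_convex :: "('a::real_vector \<Rightarrow> ereal) \<Rightarrow> bool"
  where "ereal_convex f \<longleftrightarrow>
    (\<forall>x y. \<forall>u\<ge>0. \<forall>v\<ge>0. u + v = 1 \<longrightarrow>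
      f (u *\<^sub>R x + v *\<^sub>R y) \<le> ereal u * f x + ereal v * f y)"

definition proper_lsc_convex :: "('a::real_normed_vector \<Rightarrow> ereal) \<Rightarrow> bool"
  where "proper_lsc_convex f \<longleftrightarrow> proper f \<and> lower_semicontinuous f \<and> ereal_convex f"

definition fun_div :: "('a \<Rightarrow> ereal) \<Rightarrow> real \<Rightarrow> 'a \<Rightarrow> ereal"
  where "fun_div f c = (\<lambda>x. f x / ereal c)"

definition fenchel_conjugate :: "('a::real_inner \<Rightarrow> ereal) \<Rightarrow> 'a \<Rightarrow> ereal"
  where "fenchel_conjugate f u = (SUP x. ereal (inner u x) - f x)"

text \<open>For proper \<open>f\<close> this is empty wherever \<open>f x = \<infinity>\<close>.\<close>

definition subdifferential :: "('a::real_inner \<Rightarrow> ereal) \<Rightarrow> 'a \<Rightarrow> 'a set"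
  where "subdifferential f x = {u. \<forall>y. f x + ereal (inner u (y - x)) \<le> f y}"

text \<open>The set-valued operator \<open>(Id + \<partial>f)\<^sup>-\<^sup>1\<close>.\<close>

definition resolvent :: "('a::real_inner \<Rightarrow> ereal) \<Rightarrow> 'a \<Rightarrow> 'a set"
  where "resolvent f x = {p. x \<in> {p + u |u. u \<in> subdifferential f p}}"

text \<open>For proper lower semicontinuous convex \<open>f\<close> on a Hilbert space, \<^term>\<open>resolvent f x\<close> is a
  singleton for every \<open>x\<close>, and \<open>prox f\<close> is the corresponding function.\<close>

definition prox :: "('a::real_inner \<Rightarrow> ereal) \<Rightarrow> 'a \<Rightarrow> 'a"
  where "prox f x = (THE p. p \<in> resolvent f x)"

definition Fix :: "('a \<Rightarrow> 'a) \<Rightarrow> 'a set"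
  where "Fix T = {x. T x = x}"

text \<open>For proper \<open>f1\<close>, \<open>f2\<close> both conjugates omit \<open>-\<infinity>\<close>, so the differences below never
  involve \<open>\<infinity> - \<infinity>\<close>.\<close>

definition dual_objective ::
  "('a::real_inner \<Rightarrow> ereal) \<Rightarrow> ('a \<Rightarrow> ereal) \<Rightarrow> real \<Rightarrow> real \<Rightarrow> 'a \<Rightarrow> ereal"
  where "dual_objective f1 f2 l1 l2 \<phi> =
    - fenchel_conjugate (fun_div f1 l2) (- \<phi>) - fenchel_conjugate (fun_div f2 l1) \<phi>
      - ereal ((norm \<phi>)\<^sup>2 / 2)"

definition dual_solution ::
  "('a::real_inner \<Rightarrow> ereal) \<Rightarrow> ('a \<Rightarrow> ereal) \<Rightarrow> real \<Rightarrow> real \<Rightarrow> 'a \<Rightarrow> bool"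
  where "dual_solution f1 f2 l1 l2 \<phi> \<longleftrightarrow>
    \<bar>dual_objective f1 f2 l1 l2 \<phi>\<bar> \<noteq> \<infinity> \<and>
    (\<forall>\<psi>. dual_objective f1 f2 l1 l2 \<psi> \<le> dual_objective f1 f2 l1 l2 \<phi>)"


text \<open>There is at most one dual solution, so one may speak of \<^emph>\<open>the\<close> dual solution.\<close>

lemma fenchel_conjugate_midpoint:
  fixes f :: "'a::real_inner \<Rightarrow> ereal"
  assumes "fenchel_conjugate f u = ereal a" "fenchel_conjugate f v = ereal b"
  shows "fenchel_conjugate f ((1/2) *\<^sub>R (u + v)) \<le> ereal ((a + b) / 2)"
  unfolding fenchel_conjugate_def
proof (rule SUP_least)
  fix x
  have "ereal (inner u x) - f x \<le> ereal a" "ereal (inner v x) - f x \<le> ereal b"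
    unfolding assms[symmetric] fenchel_conjugate_def by (rule SUP_upper, simp)+
  then show "ereal (inner ((1/2) *\<^sub>R (u + v)) x) - f x \<le> ereal ((a + b) / 2)"
    by (cases "f x") (auto simp: inner_left_distrib field_simps)
qed

lemma dual_solution_unique:
  fixes f1 f2 :: "'a::real_inner \<Rightarrow> ereal"
  assumes "dual_solution f1 f2 l1 l2 \<phi>" "dual_solution f1 f2 l1 l2 \<psi>"
  shows "\<phi> = \<psi>"
proof -
  let ?D = "dual_objective f1 f2 l1 l2"
  let ?g = "fenchel_conjugate (fun_div f1 l2)" and ?h = "fenchel_conjugate (fun_div f2 l1)"
  let ?m = "(1/2) *\<^sub>R (\<phi> + \<psi>)"
  have fin: "\<bar>?D \<phi>\<bar> \<noteq> \<infinity>" "\<bar>?D \<psi>\<bar> \<noteq> \<infinity>" and eq: "?D \<phi> = ?D \<psi>"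
    and mid: "?D ?m \<le> ?D \<phi>"
    using assms by (auto simp: dual_solution_def intro: antisym)
  obtain a where a: "?g (- \<phi>) = ereal a"
    using fin by (cases "?g (- \<phi>)"; cases "?h \<phi>") (auto simp: dual_objective_def)
  obtain b where b: "?h \<phi> = ereal b"
    using fin by (cases "?g (- \<phi>)"; cases "?h \<phi>") (auto simp: dual_objective_def)
  obtain c where c: "?g (- \<psi>) = ereal c"
    using fin by (cases "?g (- \<psi>)"; cases "?h \<psi>") (auto simp: dual_objective_def)
  obtain d where d: "?h \<psi> = ereal d"
    using fin by (cases "?g (- \<psi>)"; cases "?h \<psi>") (auto simp: dual_objective_def)
  have "(1/2) *\<^sub>R (- \<phi> + - \<psi>) = - ?m"
    by (simp add: scaleR_right_diff_distrib scaleR_right_distrib)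
  then have g: "?g (- ?m) \<le> ereal ((a + c) / 2)"
    using fenchel_conjugate_midpoint[OF a c] by metis
  have h: "?h ?m \<le> ereal ((b + d) / 2)"
    by (rule fenchel_conjugate_midpoint[OF b d])
  have *: "ereal (- ((a + c) / 2) - (b + d) / 2 - (norm ?m)\<^sup>2 / 2) \<le> ?D ?m"
    using g h unfolding dual_objective_def
    by (cases "?g (- ?m)"; cases "?h ?m") (auto, argo)
  have D: "?D \<phi> = ereal (- a - b - (norm \<phi>)\<^sup>2 / 2)" "?D \<psi> = ereal (- c - d - (norm \<psi>)\<^sup>2 / 2)"
    by (simp_all add: dual_objective_def a b c d)
  have 1: "- ((a + c) / 2) - (b + d) / 2 - (norm ?m)\<^sup>2 / 2 \<le> - a - b - (norm \<phi>)\<^sup>2 / 2"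
    using order_trans[OF * mid] unfolding D by simp
  have 2: "- a - b - (norm \<phi>)\<^sup>2 / 2 = - c - d - (norm \<psi>)\<^sup>2 / 2"
    using eq unfolding D by simp
  have 3: "(norm ?m)\<^sup>2 = (norm \<phi>)\<^sup>2 / 2 + (norm \<psi>)\<^sup>2 / 2 - (norm (\<phi> - \<psi>))\<^sup>2 / 4"
    by (simp add: power2_norm_eq_inner inner_left_distrib inner_right_distrib
        inner_diff_left inner_diff_right inner_commute field_simps)
  have "(norm (\<phi> - \<psi>))\<^sup>2 \<le> 0"
    using 1 2 3 by argo
  then show ?thesis by simp
qed

end

theory Submission
  imports Defs
begin

text \<open>
  Write \<open>g = f1 / l2\<close> and \<open>h = f2 / l1\<close>. Every proximal equation \<open>prox f x = p\<close> is the inclusion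
  \<open>x - p \<in> \<partial>f p\<close> (lemma \<open>prox_eq_iff\<close>), and dividing a function by \<open>c\<close> divides its subgradients
  by \<open>c\<close>. Both fixed point problems thereby become the same question about pairs \<open>(x, y)\<close>
  with \<open>x - y \<in> \<partial>h y\<close> and \<open>y - x \<in> \<partial>g x\<close>.

  Indeed \<open>x \<in> E\<close> with \<open>y = prox h x\<close> says exactly this. On the other side let \<open>z = l1 x + l2 y\<close>.
  Since \<open>l1 + l2 = 1\<close>, \<open>z - x = l2 (y - x)\<close> and \<open>z - y = l1 (x - y)\<close>, and the two inclusions turn
  into \<open>x = prox f1 z\<close> and \<open>y = prox f2 z\<close>: the averaging weights cancel the scalings of the
  functions. Hence \<open>x \<mapsto> l1 x + l2 prox h x\<close> and \<open>prox f1\<close> are mutually inverse between \<open>E\<close> and \<open>F\<close>.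

  Continuity comes from duality. For any such pair, \<open>x - y\<close> satisfies the Fenchel-Young equality
  for both functions and therefore maximizes the dual objective
  (lemma \<open>dual_solution_of_subgradients\<close>). The dual solution is unique, so the gap \<open>x - y\<close> is the
  same vector \<open>\<phi>\<close> for all pairs, and on \<open>E\<close> the map is the translation by \<open>- l2 \<phi>\<close>.

  What remains is that \<open>prox f\<close> really is an element of the resolvent. Here lower semicontinuity,
  convexity and completeness enter: \<open>f + \<parallel>\<cdot> - x\<parallel>\<^sup>2 / 2\<close> is bounded below, its minimizing sequences
  are Cauchy by the parallelogram law, and its minimizer is the proximal point.
\<close>

section \<open>Existence and uniqueness of the proximal point\<close>

text \<open>The defining condition uses the punctured filter \<open>at x\<close>; adding the point itself costs
  nothing and gives a form that can be tested along any convergent sequence.\<close>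

lemma lower_semicontinuous_iff_eventually:
  "lower_semicontinuous f \<longleftrightarrow> (\<forall>x. \<forall>c < f x. eventually (\<lambda>y. c < f y) (nhds x))"
  unfolding lower_semicontinuous_def le_Liminf_iff eventually_nhds_conv_at by blast

text \<open>Near a point \<open>x\<^sub>0\<close> of the domain, \<open>f\<close> drops by at most \<open>1\<close> on some closed ball of radius \<open>s\<close>.
  Convexity along the segment from \<open>x\<^sub>0\<close> to a far point \<open>y\<close> propagates this: a fall steeper than
  \<open>1 / s\<close> per unit of length would already be visible where the segment leaves the ball.\<close>

lemma proper_lsc_convex_linear_lower_bound:
  fixes f :: "'a::real_normed_vector \<Rightarrow> ereal"
  assumes "proper_lsc_convex f"
  obtains x0 a K where "K \<ge> 0" "\<And>y. ereal (a - K * norm (y - x0)) \<le> f y"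
proof -
  have ninf: "\<And>y. f y \<noteq> -\<infinity>" and lsc: "lower_semicontinuous f" and conv: "ereal_convex f"
    using assms by (auto simp: proper_lsc_convex_def proper_def)
  obtain x0 b where x0: "f x0 = ereal b"
    using assms unfolding proper_lsc_convex_def proper_def by (metis ereal_cases)
  have "eventually (\<lambda>y. ereal (b - 1) < f y) (nhds x0)"
    using lsc x0 unfolding lower_semicontinuous_iff_eventually by simp
  then obtain r where r: "r > 0" "\<And>y. dist y x0 < r \<Longrightarrow> ereal (b - 1) < f y"
    unfolding eventually_nhds_metric by blast
  define s where "s = r / 2"
  have s: "s > 0" "\<And>y. norm (y - x0) \<le> s \<Longrightarrow> ereal (b - 1) < f y"
    using r by (auto simp: s_def dist_norm)
  have "ereal (b - 1 - (1 / s) * norm (y - x0)) \<le> f y" for y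
  proof (cases "norm (y - x0) \<le> s")
    case True
    have "ereal (b - 1 - (1 / s) * norm (y - x0)) \<le> ereal (b - 1)"
      using s(1) by simp
    then show ?thesis using s(2)[OF True] by (meson less_imp_le order_trans)
  next
    case False
    define t where "t = s / norm (y - x0)"
    have n: "norm (y - x0) > 0" using False s(1) by linarith
    have t: "0 < t" "t < 1" using False s(1) n by (auto simp: t_def)
    define w where "w = (1 - t) *\<^sub>R x0 + t *\<^sub>R y"
    have "w - x0 = t *\<^sub>R (y - x0)" by (simp add: w_def algebra_simps)
    then have "norm (w - x0) = s" using n s(1) by (simp add: t_def)
    then have "ereal (b - 1) < f w" using s(2) by simp
    also have "f w \<le> ereal (1 - t) * f x0 + ereal t * f y"
      using conv t unfolding ereal_convex_def w_def by simp
    finally have *: "ereal (b - 1) < ereal (1 - t) * f x0 + ereal t * f y" .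
    show ?thesis
    proof (cases "f y")
      case (real c)
      have "b - 1 < (1 - t) * b + t * c" using * real x0 by simp
      then have "t * (b - 1 / t) < t * c" using t by (simp add: algebra_simps)
      then have "b - 1 / t < c" using t by simp
      then show ?thesis using real by (simp add: t_def)
    qed (use ninf in auto)
  qed
  then show ?thesis using that[of "1 / s" "b - 1" x0] s(1) by simp
qed

text \<open>A quadratic beats the linear decrease allowed by
  \<open>proper_lsc_convex_linear_lower_bound\<close>, and completing the square in
  \<open>\<parallel>y - x\<parallel>\<close> gives the constant.\<close>

lemma proximal_objective_bounded_below:
  fixes f :: "'a::real_normed_vector \<Rightarrow> ereal"
  assumes "proper_lsc_convex f"
  obtains B where "\<And>y. ereal B \<le> f y + ereal ((norm (y - x))\<^sup>2 / 2)"
proof -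
  obtain x0 a K where K: "K \<ge> 0" "\<And>y. ereal (a - K * norm (y - x0)) \<le> f y"
    by (rule proper_lsc_convex_linear_lower_bound[OF assms]) (rule that)
  have "ereal (a - K * norm (x - x0) - K\<^sup>2 / 2) \<le> f y + ereal ((norm (y - x))\<^sup>2 / 2)" for y
  proof -
    have "norm (y - x0) \<le> norm (y - x) + norm (x - x0)"
      using norm_triangle_ineq[of "y - x" "x - x0"] by simp
    then have "K * norm (y - x0) \<le> K * norm (y - x) + K * norm (x - x0)"
      using mult_left_mono[of "norm (y - x0)" "norm (y - x) + norm (x - x0)" K] K(1)
      by (simp only: distrib_left)
    moreover have "0 \<le> (norm (y - x))\<^sup>2 + K\<^sup>2 - 2 * (K * norm (y - x))"
      using zero_le_power2[of "norm (y - x) - K"] by (simp add: power2_diff mult_ac)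
    ultimately have "a - K * norm (x - x0) - K\<^sup>2 / 2
        \<le> a - K * norm (y - x0) + (norm (y - x))\<^sup>2 / 2"
      by linarith
    then have "ereal (a - K * norm (x - x0) - K\<^sup>2 / 2)
        \<le> ereal (a - K * norm (y - x0)) + ereal ((norm (y - x))\<^sup>2 / 2)"
      by simp
    also have "\<dots> \<le> f y + ereal ((norm (y - x))\<^sup>2 / 2)"
      by (rule add_right_mono[OF K(2)])
    finally show ?thesis .
  qed
  then show ?thesis by (rule that)
qed

text \<open>The parallelogram law makes the midpoint of two almost minimal points better than their
  average by \<open>\<parallel>y - z\<parallel>\<^sup>2 / 8\<close>. As it cannot go below the infimum, almost minimal points are close
  to each other. This is the estimate that makes minimizing sequences Cauchy.\<close>

lemma proximal_objective_almost_minimal_close: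
  fixes f :: "'a::real_inner \<Rightarrow> ereal"
  assumes conv: "ereal_convex f"
    and low: "\<And>w. ereal m \<le> f w + ereal ((norm (w - x))\<^sup>2 / 2)"
    and y: "f y + ereal ((norm (y - x))\<^sup>2 / 2) \<le> ereal (m + e)"
    and z: "f z + ereal ((norm (z - x))\<^sup>2 / 2) \<le> ereal (m + e)"
  shows "(norm (y - z))\<^sup>2 \<le> 8 * e"
proof -
  obtain b where b: "f y = ereal b" using low[of y] y by (cases "f y") auto
  obtain c where c: "f z = ereal c" using low[of z] z by (cases "f z") auto
  define w where "w = (1/2) *\<^sub>R y + (1/2) *\<^sub>R z"
  have "f w \<le> ereal (1/2) * f y + ereal (1/2) * f z"
    using conv[unfolded ereal_convex_def, rule_format, of "1/2" "1/2" y z] by (simp add: w_def)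
  then have "f w \<le> ereal ((b + c) / 2)" using b c by (simp add: add_divide_distrib)
  then have "f w + ereal ((norm (w - x))\<^sup>2 / 2)
      \<le> ereal ((b + c) / 2) + ereal ((norm (w - x))\<^sup>2 / 2)"
    by (rule add_right_mono)
  from order_trans[OF low[of w] this]
  have 1: "m \<le> (b + c) / 2 + (norm (w - x))\<^sup>2 / 2" by simp
  have 2: "(norm (w - x))\<^sup>2
      = (norm (y - x))\<^sup>2 / 2 + (norm (z - x))\<^sup>2 / 2 - (norm (y - z))\<^sup>2 / 4"
  proof -
    have "(norm ((1/2) *\<^sub>R (u + v)))\<^sup>2
        = (norm u)\<^sup>2 / 2 + (norm v)\<^sup>2 / 2 - (norm (u - v))\<^sup>2 / 4" for u v :: 'a
      by (simp add: power2_norm_eq_inner inner_left_distrib inner_right_distrib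
          inner_diff_left inner_diff_right inner_commute field_simps)
    moreover have "w - x = (1/2) *\<^sub>R ((y - x) + (z - x))"
      unfolding w_def by (simp add: algebra_simps flip: scaleR_left_distrib)
    moreover have "y - z = (y - x) - (z - x)" by simp
    ultimately show ?thesis by (simp only:)
  qed
  have "b + (norm (y - x))\<^sup>2 / 2 \<le> m + e" "c + (norm (z - x))\<^sup>2 / 2 \<le> m + e"
    using y z b c by auto
  with 1 2 show ?thesis by argo
qed

lemma proximal_objective_has_minimizer:
  fixes f :: "'a::{real_inner, complete_space} \<Rightarrow> ereal"
  assumes f: "proper_lsc_convex f"
  obtains p where "\<And>y. f p + ereal ((norm (p - x))\<^sup>2 / 2) \<le> f y + ereal ((norm (y - x))\<^sup>2 / 2)"
proof -
  define G where "G y = f y + ereal ((norm (y - x))\<^sup>2 / 2)" for y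
  have lsc: "lower_semicontinuous f" and conv: "ereal_convex f"
    using f by (auto simp: proper_lsc_convex_def)
  obtain B where B: "\<And>y. ereal B \<le> f y + ereal ((norm (y - x))\<^sup>2 / 2)"
    by (rule proximal_objective_bounded_below[OF f, of x]) (rule that)
  obtain x0 where x0: "f x0 \<noteq> \<infinity>" "f x0 \<noteq> -\<infinity>"
    using f by (auto simp: proper_lsc_convex_def proper_def)
  have "ereal B \<le> (INF y. G y)" unfolding G_def by (rule INF_greatest) (rule B)
  moreover have "(INF y. G y) \<le> G x0" by (rule INF_lower) simp
  moreover have "G x0 \<noteq> \<infinity>" using x0 by (auto simp: G_def)
  ultimately obtain m where m: "(INF y. G y) = ereal m" by (cases "INF y. G y") auto
  have low: "ereal m \<le> G y" for y using m INF_lower[of y UNIV G] by simp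
  have "\<exists>y. G y \<le> ereal (m + 1 / Suc n)" for n
  proof -
    have "(INF y. G y) < ereal (m + 1 / Suc n)" using m by simp
    then show ?thesis unfolding INF_less_iff by (auto intro: less_imp_le)
  qed
  then obtain q where q: "\<And>n. G (q n) \<le> ereal (m + 1 / Suc n)" by metis
  have close: "(norm (q i - q j))\<^sup>2 \<le> 8 * (1 / Suc n)" if "i \<ge> n" "j \<ge> n" for i j n
  proof -
    have "G (q k) \<le> ereal (m + 1 / Suc n)" if "k \<ge> n" for k
    proof -
      have "1 / real (Suc k) \<le> 1 / real (Suc n)" using that by (simp add: frac_le)
      then show ?thesis using q[of k] by (metis add_left_mono ereal_less_eq(3) order_trans)
    qed
    then show ?thesis
      using proximal_objective_almost_minimal_close[OF conv, of m x "q i" "1 / Suc n" "q j"] low that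
      unfolding G_def by blast
  qed
  have "Cauchy q"
  proof (rule metric_CauchyI)
    fix e :: real assume e: "e > 0"
    then obtain n where n: "1 / real (Suc n) < e\<^sup>2 / 8"
      using nat_approx_posE[of "e\<^sup>2 / 8"] by auto
    have "dist (q i) (q j) < e" if "i \<ge> n" "j \<ge> n" for i j
    proof -
      have "(norm (q i - q j))\<^sup>2 < e\<^sup>2" using close[OF that] n by linarith
      then show ?thesis using e by (simp add: dist_norm power2_less_imp_less)
    qed
    then show "\<exists>M. \<forall>i\<ge>M. \<forall>j\<ge>M. dist (q i) (q j) < e" by blast
  qed
  then obtain p where p: "q \<longlonglongrightarrow> p" using Cauchy_convergent convergent_def by blast
  define d where "d = m - (norm (p - x))\<^sup>2 / 2"
  \<comment> \<open>A value \<open>c\<close> strictly between \<open>d\<close> and \<open>f p\<close> would be exceeded by \<open>f\<close> along the sequence, whose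
    objective values nevertheless tend to the infimum \<open>m\<close>.\<close>
  have "f p \<le> ereal d"
  proof (rule ccontr)
    assume "\<not> f p \<le> ereal d"
    then obtain c where c: "ereal d < ereal c" "ereal c < f p"
      by (metis ereal_dense2 not_le)
    have ev: "eventually (\<lambda>n. ereal c < f (q n)) sequentially"
      using lsc c(2) p unfolding lower_semicontinuous_iff_eventually filterlim_iff by blast
    have lim: "(\<lambda>n. m + 1 / Suc n - (norm (q n - x))\<^sup>2 / 2) \<longlonglongrightarrow> m + 0 - (norm (p - x))\<^sup>2 / 2"
      by (intro tendsto_intros p LIMSEQ_Suc[OF lim_1_over_n]) simp
    have "eventually (\<lambda>n. c \<le> m + 1 / Suc n - (norm (q n - x))\<^sup>2 / 2) sequentially"
      using ev
    proof eventually_elim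
      case (elim n)
      then show ?case using q[of n] unfolding G_def by (cases "f (q n)") auto
    qed
    then have "c \<le> m + 0 - (norm (p - x))\<^sup>2 / 2"
      using tendsto_lowerbound[OF lim] by simp
    then show False using c(1) by (simp add: d_def)
  qed
  then have "G p \<le> ereal d + ereal ((norm (p - x))\<^sup>2 / 2)"
    unfolding G_def by (rule add_right_mono)
  then have "G p \<le> ereal m" by (simp add: d_def)
  then have "G p \<le> G y" for y using low order_trans by blast
  then show ?thesis unfolding G_def by (rule that)
qed

lemma norm_add_scaleR_squared:
  "(norm (d + t *\<^sub>R e))\<^sup>2 = (norm d)\<^sup>2 + 2 * (t * inner d e) + t * (t * (norm e)\<^sup>2)"
  for d e :: "'a::real_inner"
  using dot_norm[of d "t *\<^sub>R e"]
  by (simp add: power_mult_distrib power2_eq_square[of t] field_simps)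

text \<open>Fermat's rule: compare the minimizer with the points of the segment towards \<open>y\<close>. The
  quadratic term contributes a linear part, which is the subgradient, and an error of order \<open>t\<close>
  that disappears as \<open>t\<close> tends to \<open>0\<close>.\<close>

lemma subgradient_of_proximal_minimizer:
  fixes f :: "'a::real_inner \<Rightarrow> ereal"
  assumes f: "proper f" "ereal_convex f"
    and min: "\<And>y. f p + ereal ((norm (p - x))\<^sup>2 / 2) \<le> f y + ereal ((norm (y - x))\<^sup>2 / 2)"
  shows "x - p \<in> subdifferential f p"
proof -
  have ninf: "\<And>y. f y \<noteq> -\<infinity>" using f(1) by (simp add: proper_def)
  obtain y0 where "f y0 \<noteq> \<infinity>" using f(1) by (auto simp: proper_def)
  then obtain a where a: "f p = ereal a"
    using min[of y0] ninf[of p] by (cases "f p"; cases "f y0") auto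
  have "f p + ereal (inner (x - p) (y - p)) \<le> f y" for y
  proof (cases "f y")
    case (real b)
    let ?k = "inner (x - p) (y - p)"
    have bound: "a + ?k \<le> b + t * ((norm (y - p))\<^sup>2 / 2)" if t: "0 < t" "t < 1" for t
    proof -
      define w where "w = (1 - t) *\<^sub>R p + t *\<^sub>R y"
      have "f w \<le> ereal (1 - t) * f p + ereal t * f y"
        using f(2) t unfolding ereal_convex_def w_def by simp
      also have "\<dots> = ereal (a - t * a + t * b)" using a real by (simp add: left_diff_distrib)
      finally have "f w + ereal ((norm (w - x))\<^sup>2 / 2)
          \<le> ereal (a - t * a + t * b) + ereal ((norm (w - x))\<^sup>2 / 2)"
        by (rule add_right_mono)
      from order_trans[OF min[of w] this]
      have 1: "a + (norm (p - x))\<^sup>2 / 2 \<le> a - t * a + t * b + (norm (w - x))\<^sup>2 / 2"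
        using a by simp
      have w: "w - x = (p - x) + t *\<^sub>R (y - p)" by (simp add: w_def algebra_simps)
      have "inner (p - x) (y - p) = - ?k"
        by (metis inner_minus_left minus_diff_eq)
      then have 2: "(norm (w - x))\<^sup>2
          = (norm (p - x))\<^sup>2 - 2 * (t * ?k) + t * (t * (norm (y - p))\<^sup>2)"
        unfolding w norm_add_scaleR_squared by simp
      have "t * a + t * ?k \<le> t * b + t * (t * (norm (y - p))\<^sup>2) / 2"
        using 1 2 by argo
      then have "t * (a + ?k) \<le> t * (b + t * ((norm (y - p))\<^sup>2 / 2))"
        by (simp add: distrib_left)
      then show ?thesis using t by simp
    qed
    have "((\<lambda>t. b + t * ((norm (y - p))\<^sup>2 / 2)) \<longlongrightarrow> b + 0 * ((norm (y - p))\<^sup>2 / 2)) (at_right 0)"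
      by (intro tendsto_intros)
    moreover have "eventually (\<lambda>t. a + ?k \<le> b + t * ((norm (y - p))\<^sup>2 / 2)) (at_right 0)"
      unfolding eventually_at_right_field using bound by (intro exI[of _ 1]) auto
    ultimately have "a + ?k \<le> b + 0 * ((norm (y - p))\<^sup>2 / 2)"
      by (rule tendsto_lowerbound) simp
    then show ?thesis using a real by simp
  qed (use ninf in auto)
  then show ?thesis by (simp add: subdifferential_def)
qed

lemma subdifferential_imp_finite:
  assumes "proper f" "u \<in> subdifferential f x"
  obtains a where "f x = ereal a"
proof -
  obtain y where "f y \<noteq> \<infinity>" using assms(1) by (auto simp: proper_def)
  moreover have "f x + ereal (inner u (y - x)) \<le> f y"
    using assms(2) by (simp add: subdifferential_def)
  moreover have "f x \<noteq> -\<infinity>" using assms(1) by (simp add: proper_def)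
  ultimately show ?thesis using that by (cases "f x") auto
qed

lemma subdifferential_monotone:
  fixes f :: "'a::real_inner \<Rightarrow> ereal"
  assumes f: "proper f" and u: "u \<in> subdifferential f x" and v: "v \<in> subdifferential f y"
  shows "inner (u - v) (x - y) \<ge> 0"
proof -
  obtain a where a: "f x = ereal a" by (rule subdifferential_imp_finite[OF f u])
  obtain b where b: "f y = ereal b" by (rule subdifferential_imp_finite[OF f v])
  have "f x + ereal (inner u (y - x)) \<le> f y" "f y + ereal (inner v (x - y)) \<le> f x"
    using u v by (simp_all add: subdifferential_def)
  then show ?thesis using a b by (simp add: inner_diff_left inner_diff_right)
qed

text \<open>This is the only access to \<open>prox\<close> that the rest of the argument needs: a description
  operator becomes an inclusion that can be rescaled.\<close>

lemma prox_eq_iff: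
  fixes f :: "'a::{real_inner, complete_space} \<Rightarrow> ereal"
  assumes f: "proper_lsc_convex f"
  shows "prox f x = p \<longleftrightarrow> x - p \<in> subdifferential f p"
proof -
  have proper: "proper f" and conv: "ereal_convex f"
    using f by (simp_all add: proper_lsc_convex_def)
  have resolvent_iff: "q \<in> resolvent f x \<longleftrightarrow> x - q \<in> subdifferential f q" for q
    by (auto simp: resolvent_def intro: exI[of _ "x - q"])
  obtain r where r: "r \<in> resolvent f x"
    using proximal_objective_has_minimizer[OF f, of x]
      subgradient_of_proximal_minimizer[OF proper conv] resolvent_iff by metis
  have unique: "q = r" if "q \<in> resolvent f x" for q
  proof -
    have "inner ((x - q) - (x - r)) (q - r) \<ge> 0"
      by (rule subdifferential_monotone[OF proper])
        (use that r in \<open>simp_all add: resolvent_iff\<close>)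
    moreover have "(x - q) - (x - r) = - (q - r)" by simp
    ultimately have "inner (q - r) (q - r) \<le> 0" by (simp only: inner_minus_left)
    then show ?thesis by (metis inner_gt_zero_iff not_le right_minus_eq)
  qed
  have "prox f x = r"
    unfolding prox_def using r unique by (rule the_equality)
  then show ?thesis using r unique resolvent_iff by metis
qed

section \<open>Scaling a function\<close>

lemma subdifferential_fun_div:
  assumes "c > 0"
  shows "u \<in> subdifferential (fun_div f c) x \<longleftrightarrow> c *\<^sub>R u \<in> subdifferential f x"
proof -
  have "r / c + k = (r + c * k) / c" for r k
    using assms by (simp add: field_simps)
  then have "f x / ereal c + ereal k \<le> f y / ereal c \<longleftrightarrow> f x + ereal (c * k) \<le> f y" for y k
    using assms by (cases "f x"; cases "f y") (auto simp: divide_le_cancel)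
  then show ?thesis by (simp add: subdifferential_def fun_div_def)
qed

lemma proper_lsc_convex_fun_div:
  fixes f :: "'a::real_normed_vector \<Rightarrow> ereal"
  assumes f: "proper_lsc_convex f" and c: "c > 0"
  shows "proper_lsc_convex (fun_div f c)"
proof -
  have ninf: "\<And>x. f x \<noteq> -\<infinity>" using f by (simp add: proper_lsc_convex_def proper_def)
  have "f x / ereal c = -\<infinity> \<longleftrightarrow> f x = -\<infinity>" "f x / ereal c = \<infinity> \<longleftrightarrow> f x = \<infinity>" for x
    using c by (cases "f x"; simp)+
  then have "proper (fun_div f c)"
    using f by (simp add: proper_lsc_convex_def proper_def fun_div_def)
  moreover have "lower_semicontinuous (fun_div f c)"
  proof -
    have "d < f x / ereal c \<longleftrightarrow> ereal c * d < f x" for d x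
      using c by (cases d; cases "f x") (auto simp: field_simps)
    then show ?thesis
      using f unfolding proper_lsc_convex_def lower_semicontinuous_iff_eventually fun_div_def
      by simp
  qed
  moreover have "ereal_convex (fun_div f c)"
    unfolding ereal_convex_def fun_div_def
  proof (intro allI impI)
    fix x y :: 'a and u v :: real assume uv: "0 \<le> u" "0 \<le> v" "u + v = 1"
    let ?w = "u *\<^sub>R x + v *\<^sub>R y"
    have "f ?w / ereal c \<le> (ereal u * f x + ereal v * f y) / ereal c"
      using f uv c by (intro ereal_divide_right_mono)
        (simp_all add: proper_lsc_convex_def ereal_convex_def)
    also have "\<dots> = ereal u * (f x / ereal c) + ereal v * (f y / ereal c)"
      using ninf[of x] ninf[of y] c uv
      by (cases "f x"; cases "f y"; cases "u = 0"; cases "v = 0")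
        (auto simp: add_divide_distrib)
    finally show "f ?w / ereal c \<le> ereal u * (f x / ereal c) + ereal v * (f y / ereal c)" .
  qed
  ultimately show ?thesis by (simp add: proper_lsc_convex_def)
qed

section \<open>Duality\<close>

lemma fenchel_young: "ereal (inner u x) - f x \<le> fenchel_conjugate f u"
  unfolding fenchel_conjugate_def by (rule SUP_upper) simp

lemma fenchel_conjugate_of_subgradient:
  assumes u: "u \<in> subdifferential f x" and a: "f x = ereal a"
  shows "fenchel_conjugate f u = ereal (inner u x - a)"
proof (rule antisym)
  show "ereal (inner u x - a) \<le> fenchel_conjugate f u"
    using fenchel_young[of u x f] a by simp
  show "fenchel_conjugate f u \<le> ereal (inner u x - a)"
    unfolding fenchel_conjugate_def
  proof (rule SUP_least)
    fix y
    have "f x + ereal (inner u (y - x)) \<le> f y" using u by (simp add: subdifferential_def)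
    then show "ereal (inner u y) - f y \<le> ereal (inner u x - a)"
      using a by (cases "f y") (auto simp: inner_diff_right)
  qed
qed

text \<open>With \<open>g x = a\<close>, \<open>h y = b\<close>, the Fenchel-Young inequality bounds the dual objective at any
  \<open>\<psi>\<close> by \<open>a + b + \<langle>\<psi>, x - y\<rangle> - \<parallel>\<psi>\<parallel>\<^sup>2 / 2\<close>, which is largest at \<open>\<psi> = x - y\<close>. There the inequality is
  an equality because of the subgradient conditions.\<close>

lemma dual_solution_of_subgradients:
  fixes f1 f2 :: "'a::real_inner \<Rightarrow> ereal"
  assumes proper: "proper (fun_div f1 l2)" "proper (fun_div f2 l1)"
    and x: "y - x \<in> subdifferential (fun_div f1 l2) x"
    and y: "x - y \<in> subdifferential (fun_div f2 l1) y"
  shows "dual_solution f1 f2 l1 l2 (x - y)"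
proof -
  let ?g = "fun_div f1 l2" and ?h = "fun_div f2 l1"
  obtain a where a: "?g x = ereal a" by (rule subdifferential_imp_finite[OF proper(1) x])
  obtain b where b: "?h y = ereal b" by (rule subdifferential_imp_finite[OF proper(2) y])
  have "fenchel_conjugate ?g (- (x - y)) = ereal (inner (y - x) x - a)"
    using fenchel_conjugate_of_subgradient[OF x a] by simp
  moreover have "fenchel_conjugate ?h (x - y) = ereal (inner (x - y) y - b)"
    by (rule fenchel_conjugate_of_subgradient[OF y b])
  ultimately have attained: "dual_objective f1 f2 l1 l2 (x - y) = ereal (a + b + (norm (x - y))\<^sup>2 / 2)"
    by (simp add: dual_objective_def power2_norm_eq_inner inner_diff_left inner_diff_right
        inner_commute field_simps)
  have "dual_objective f1 f2 l1 l2 \<psi> \<le> ereal (a + b + (norm (x - y))\<^sup>2 / 2)" for \<psi>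
  proof -
    have g: "ereal (inner (- \<psi>) x - a) \<le> fenchel_conjugate ?g (- \<psi>)"
      using fenchel_young[of "- \<psi>" x ?g] a by simp
    have h: "ereal (inner \<psi> y - b) \<le> fenchel_conjugate ?h \<psi>"
      using fenchel_young[of \<psi> y ?h] b by simp
    have "inner \<psi> (x - y) \<le> (norm \<psi>)\<^sup>2 / 2 + (norm (x - y))\<^sup>2 / 2"
      by (simp add: dot_norm_neg field_simps)
    then have "- (inner (- \<psi>) x - a) - (inner \<psi> y - b) - (norm \<psi>)\<^sup>2 / 2
        \<le> a + b + (norm (x - y))\<^sup>2 / 2"
      unfolding inner_diff_right inner_minus_left by linarith
    then show ?thesis
      using g h unfolding dual_objective_def
      by (cases "fenchel_conjugate ?g (- \<psi>)"; cases "fenchel_conjugate ?h \<psi>") auto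
  qed
  then show ?thesis using attained by (simp add: dual_solution_def)
qed

section \<open>The two fixed point sets\<close>

theorem theorem4p12:
  fixes f1 f2 :: "'a::{real_inner, complete_space} \<Rightarrow> ereal"
    and l1 l2 :: real
    and \<phi> :: 'a
    and E F :: "'a set"
    and T1 :: "'a \<Rightarrow> 'a"
  assumes "proper_lsc_convex f1" and "proper_lsc_convex f2"
    and "l1 > 0" and "l2 > 0" and "l1 + l2 = 1"
    and "dual_solution f1 f2 l1 l2 \<phi>"
  defines "E \<equiv> Fix (prox (fun_div f1 l2) \<circ> prox (fun_div f2 l1))"
    and "F \<equiv> Fix (\<lambda>x. l1 *\<^sub>R prox f1 x + l2 *\<^sub>R prox f2 x)"
    and "T1 \<equiv> \<lambda>x. l1 *\<^sub>R x + l2 *\<^sub>R prox (fun_div f2 l1) x"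
  shows "(\<forall>x\<in>E. T1 x = x - l2 *\<^sub>R \<phi>) \<and>
    homeomorphism E F T1 (prox f1) \<and>
    F = (\<lambda>x. x - l2 *\<^sub>R \<phi>) ` E"
proof -
  let ?g = "fun_div f1 l2" and ?h = "fun_div f2 l1"
  note f = assms(1,2) and l = assms(3-5)
  have g: "proper_lsc_convex ?g" and h: "proper_lsc_convex ?h"
    using f l by (simp_all add: proper_lsc_convex_fun_div)
  have l1: "l1 = 1 - l2" using l by simp
  have E_iff: "x \<in> E \<longleftrightarrow> prox ?g (prox ?h x) = x" for x
    by (simp add: E_def Fix_def)
  \<comment> \<open>For \<open>z = l1 x + l2 y\<close> the scaled inclusions and the unscaled ones coincide.\<close>
  have prox_g_iff: "prox ?g y = x \<longleftrightarrow> prox f1 (l1 *\<^sub>R x + l2 *\<^sub>R y) = x" for x y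
  proof -
    have "l1 *\<^sub>R x + l2 *\<^sub>R y - x = l2 *\<^sub>R (y - x)" by (simp add: l1 algebra_simps)
    then show ?thesis
      by (simp add: prox_eq_iff[OF g] prox_eq_iff[OF f(1)] subdifferential_fun_div[OF l(2)])
  qed
  have prox_h_iff: "prox ?h x = y \<longleftrightarrow> prox f2 (l1 *\<^sub>R x + l2 *\<^sub>R y) = y" for x y
  proof -
    have "l1 *\<^sub>R x + l2 *\<^sub>R y - y = l1 *\<^sub>R (x - y)" by (simp add: l1 algebra_simps)
    then show ?thesis
      by (simp add: prox_eq_iff[OF h] prox_eq_iff[OF f(2)] subdifferential_fun_div[OF l(1)])
  qed
  have T1: "T1 x = x - l2 *\<^sub>R \<phi>" if "x \<in> E" for x
  proof -
    define y where "y = prox ?h x"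
    have y: "prox ?h x = y" "prox ?g y = x" using that by (simp_all add: E_iff y_def)
    have "dual_solution f1 f2 l1 l2 (x - y)"
      using dual_solution_of_subgradients[of f1 l2 f2 l1 y x] g h y
      by (simp add: prox_eq_iff[OF g] prox_eq_iff[OF h] proper_lsc_convex_def)
    then have gap: "\<phi> = x - y" by (rule dual_solution_unique[OF assms(6)])
    then show ?thesis unfolding T1_def y(1) gap by (simp add: l1 algebra_simps)
  qed
  have T1_in_F: "T1 x \<in> F" and prox_T1: "prox f1 (T1 x) = x" if "x \<in> E" for x
  proof -
    define y where "y = prox ?h x"
    have y: "prox ?h x = y" "prox ?g y = x" using that by (simp_all add: E_iff y_def)
    have T1_x: "T1 x = l1 *\<^sub>R x + l2 *\<^sub>R y" by (simp add: T1_def y(1))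
    have "prox f1 (T1 x) = x" "prox f2 (T1 x) = y"
      using y prox_g_iff prox_h_iff unfolding T1_x by blast+
    then show "T1 x \<in> F" "prox f1 (T1 x) = x"
      by (simp_all add: F_def Fix_def T1_x)
  qed
  have prox_in_E: "prox f1 z \<in> E" and T1_prox: "T1 (prox f1 z) = z" if "z \<in> F" for z
  proof -
    define x y where "x = prox f1 z" and "y = prox f2 z"
    have z: "l1 *\<^sub>R x + l2 *\<^sub>R y = z" using that by (simp add: F_def Fix_def x_def y_def)
    have "prox ?g y = x" unfolding prox_g_iff z by (simp add: x_def)
    moreover have yx: "prox ?h x = y" unfolding prox_h_iff z by (simp add: y_def)
    ultimately have "x \<in> E" by (simp add: E_iff)
    moreover have "T1 x = z" by (simp add: T1_def yx z)
    ultimately show "prox f1 z \<in> E" "T1 (prox f1 z) = z" by (simp_all add: x_def)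
  qed
  have image_E: "T1 ` E = F" using T1_in_F prox_in_E T1_prox by force
  have "prox f1 ` F = E" using T1_in_F prox_in_E prox_T1 by force
  moreover have "continuous_on E T1"
    using T1 by (subst continuous_on_cong[OF refl, of _ _ "\<lambda>x. x - l2 *\<^sub>R \<phi>"])
      (auto intro!: continuous_intros)
  moreover have "continuous_on F (prox f1)"
  proof -
    \<comment> \<open>The inverse of a translation is a translation.\<close>
    have "prox f1 z = z + l2 *\<^sub>R \<phi>" if "z \<in> F" for z
      using T1[OF prox_in_E[OF that]] T1_prox[OF that] by (simp add: algebra_simps)
    then show ?thesis
      by (subst continuous_on_cong[OF refl, of _ _ "\<lambda>z. z + l2 *\<^sub>R \<phi>"])
        (auto intro!: continuous_intros)
  qed
  ultimately have "homeomorphism E F T1 (prox f1)"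
    using image_E prox_T1 T1_prox by (simp add: homeomorphism_def)
  moreover have "F = (\<lambda>x. x - l2 *\<^sub>R \<phi>) ` E"
    using image_E T1 by (metis image_cong)
  ultimately show ?thesis using T1 by blast
qed

end
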